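(* For any positive integer $d$ and any integer $m$ with $2\le m\le 15$, define for $0\le i\le d$ \[ b_m(d,i)=\sum_{h=0}^{m-1}\frac{i(h-m+1)+m}{(h+1)m}\binom{i-1+h}{h}\binom{d-i+h}{h}. \] Then the sequence $\{b_m(d,i)\}_{i=0}^{d}$ is a $d$-sequence.
   Context: Binomial coefficients are $\binom{x}{h}=x(x-1)\cdots(x-h+1)/h!$ for integers $h\ge 0$ (so $\binom{-1}{0}=1$). A finite sequence $\Gamma=\{\gamma_k\}_{k=0}^{n}$ of real numbers is an $n$-sequence if for every real polynomial $f(t)=\sum_{k=0}^{n}a_kt^k$ of degree at most $n$ having only real zeros, the polynomial $\Gamma[f(t)]=\sum_{k=0}^{n}\gamma_k a_k t^k$ also has only real zeros. *)

theory Defs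
  imports Complex_Main "HOL-Computational_Algebra.Polynomial"
begin

text \<open>By the usual convention, the zero polynomial counts as having only real zeros.\<close>

definition only_real_zeros :: "real poly \<Rightarrow> bool" where
  "only_real_zeros f \<longleftrightarrow>
     f = 0 \<or> (\<forall>z::complex. poly (map_poly complex_of_real f) z = 0 \<longrightarrow> z \<in> \<real>)"

definition diag_op :: "nat \<Rightarrow> (nat \<Rightarrow> real) \<Rightarrow> real poly \<Rightarrow> real poly" where
  "diag_op n \<gamma> f = (\<Sum>k\<le>n. monom (\<gamma> k * coeff f k) k)"

text \<open>Only the values \<open>\<gamma> 0, \<dots>, \<gamma> n\<close> matter, so a finite sequence is given by any
  function extending it.\<close>

definition n_sequence :: "nat \<Rightarrow> (nat \<Rightarrow> real) \<Rightarrow> bool" where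
  "n_sequence n \<gamma> \<longleftrightarrow>
     (\<forall>f. degree f \<le> n \<longrightarrow> only_real_zeros f \<longrightarrow> only_real_zeros (diag_op n \<gamma> f))"

text \<open>All arithmetic is in the reals: \<open>i - 1 + h\<close> is \<open>-1\<close> for \<open>i = h = 0\<close>, where
  truncated subtraction would be wrong, and \<open>h - m + 1\<close> is nonpositive.\<close>

definition b :: "nat \<Rightarrow> nat \<Rightarrow> nat \<Rightarrow> real" where
  "b m d i =
     (\<Sum>h=0..m-1. (real i * (real h - real m + 1) + real m) / ((real h + 1) * real m)
        * ((real i - 1 + real h) gchoose h) * ((real d - real i + real h) gchoose h))"

end

theory Submission
  imports Defs "HOL-Computational_Algebra.Fundamental_Theorem_Algebra"
    "HOL-Computational_Algebra.Formal_Power_Series"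
begin

text \<open>
  The linear sequences \<open>k + s\<close> with \<open>s > 0\<close> and \<open>t - k\<close> with \<open>t > n\<close> are \<open>n\<close>-sequences, because
  the logarithmic derivative of a real-rooted polynomial has a controlled imaginary part off the
  real line. Hence so is \<open>k (n - k) + r = (k + s) (t - k)\<close> for every \<open>r > 0\<close>, and it suffices to
  write \<open>b m d i\<close> as a polynomial \<open>q\<close> in \<open>x = i (d - i)\<close> all of whose zeros are negative.

  As \<open>b m d i\<close> is the sum over \<open>h < m\<close> of
  \<open>(i / m + (1 - i) / (h + 1)) (-i choose h) (i - d - 1 choose h)\<close>, Vandermonde's identity
  evaluates it at \<open>i = -k\<close> and at \<open>i = d + k\<close> for \<open>k < m\<close>. The two values agree, so the polynomial,
  which has degree \<open>2 (m - 1)\<close>, is invariant under \<open>i \<mapsto> d - i\<close>, and \<open>q\<close> exists with degree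
  \<open>m - 1\<close>. The common value at \<open>x = -k (d + k)\<close> is a positive multiple of
  \<open>(-1)\<^sup>k (m d - k (d + k))\<close>. The last factor changes sign at most once, which leaves \<open>m - 2\<close>
  distinct negative zeros of \<open>q\<close>; the remaining one is then real, and it is negative since the
  leading coefficient of \<open>q\<close> and \<open>q(0) = 1\<close> are positive.
\<close>

section \<open>Linear factors of \<open>n\<close>-sequences\<close>

lemma map_poly_of_real_mult:
  "map_poly complex_of_real (p * q) = map_poly complex_of_real p * map_poly complex_of_real q"
  by (rule poly_eqI) (simp add: coeff_map_poly coeff_mult)

lemma map_poly_of_real_add:
  "map_poly complex_of_real (p + q) = map_poly complex_of_real p + map_poly complex_of_real q"
  by (rule poly_eqI) (simp add: coeff_map_poly)

lemma map_poly_of_real_smult: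
  "map_poly complex_of_real (smult c p) = smult (complex_of_real c) (map_poly complex_of_real p)"
  by (rule poly_eqI) (simp add: coeff_map_poly)

lemma map_poly_of_real_pderiv:
  "map_poly complex_of_real (pderiv p) = pderiv (map_poly complex_of_real p)"
  by (rule poly_eqI) (simp add: coeff_map_poly coeff_pderiv)

lemmas map_poly_of_real_simps =
  map_poly_of_real_mult map_poly_of_real_add map_poly_of_real_smult
  map_poly_of_real_pderiv

text \<open>A nonconstant polynomial has a complex zero, here a real one, so a real linear factor
  splits off; the cofactor inherits the hypothesis.\<close>

lemma only_real_zeros_splits:
  assumes "only_real_zeros f" and "f \<noteq> 0"
  obtains c as where "c \<noteq> 0" and "f = smult c (\<Prod>a\<leftarrow>as. [:-a, 1:])"
proof -
  have "\<exists>c as. c \<noteq> 0 \<and> f = smult c (\<Prod>a\<leftarrow>as. [:-a, 1:])"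
    using assms
  proof (induction "degree f" arbitrary: f)
    case 0
    then obtain c where "f = [:c:]"
      by (metis degree_eq_zeroE)
    with 0 show ?case
      by (intro exI[of _ c] exI[of _ "[]"]) auto
  next
    case (Suc n)
    have "degree (map_poly complex_of_real f) = degree f"
      by (rule degree_map_poly) simp
    then obtain z where z: "poly (map_poly complex_of_real f) z = 0"
      using alg_closed_imp_poly_has_root[of "map_poly complex_of_real f"] Suc.hyps by auto
    then have "z \<in> \<real>"
      using Suc.prems by (auto simp: only_real_zeros_def)
    then obtain a where a: "z = complex_of_real a"
      by (auto elim: Reals_cases)
    have "complex_of_real (poly f a) = poly (map_poly complex_of_real f) z"
      unfolding a by (simp add: poly_altdef coeff_map_poly degree_map_poly)
    with z have "poly f a = 0"
      by simp
    then obtain g where g: "f = [:-a, 1:] * g"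
      by (auto simp: poly_eq_0_iff_dvd elim: dvdE)
    have g0: "g \<noteq> 0"
      using Suc.prems g by auto
    have "degree f = Suc (degree g)"
      unfolding g using g0 by (subst degree_mult_eq) auto
    moreover have "only_real_zeros g"
      using Suc.prems
      by (auto simp: g only_real_zeros_def map_poly_of_real_simps simp del: mult_pCons_left)
    ultimately obtain c as where "c \<noteq> 0" "g = smult c (\<Prod>a\<leftarrow>as. [:-a, 1:])"
      using Suc.hyps g0 by (metis nat.inject)
    then show ?case
      unfolding g by (intro exI[of _ c] exI[of _ "a # as"]) simp
  qed
  then show ?thesis
    using that by blast
qed

lemma degree_prod_list_linear: "degree (\<Prod>a\<leftarrow>as. [:-a, 1:] :: real poly) = length as"
proof (induction as)
  case (Cons a as)
  have "(\<Prod>a\<leftarrow>as. [:-a, 1:] :: real poly) \<noteq> 0"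
    by (auto simp: prod_list_zero_iff)
  then show ?case
    using Cons by (simp add: degree_mult_eq del: mult_pCons_left)
qed simp

lemma poly_prod_list_linear_nonreal:
  assumes "z \<notin> \<real>"
  shows "poly (map_poly complex_of_real (\<Prod>a\<leftarrow>as. [:-a, 1:])) z \<noteq> 0"
  using assms
  by (induction as) (auto simp: map_poly_of_real_simps map_poly_pCons add_eq_0_iff simp del: mult_pCons_left)

lemma poly_pderiv_prod_list_linear:
  assumes "z \<notin> \<real>"
  defines "F \<equiv> \<lambda>as. map_poly complex_of_real (\<Prod>a\<leftarrow>as. [:-a, 1:])"
  shows "poly (pderiv (F as)) z = poly (F as) z * (\<Sum>a\<leftarrow>as. 1 / (z - complex_of_real a))"
proof (induction as)
  case (Cons a as)
  have F: "F (a # as) = [:- complex_of_real a, 1:] * F as"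
    by (simp add: F_def map_poly_of_real_simps map_poly_pCons del: mult_pCons_left)
  have "z - complex_of_real a \<noteq> 0"
    using assms(1) by auto
  then show ?case
    unfolding F pderiv_mult using Cons
    by (simp add: pderiv_pCons field_simps del: mult_pCons_left)
qed (simp add: F_def)

section \<open>Diagonal operators\<close>

lemma coeff_diag_op: "coeff (diag_op n \<gamma> f) k = (if k \<le> n then \<gamma> k * coeff f k else 0)"
  by (auto simp: diag_op_def coeff_sum)

lemma Im_sum_list: "Im (\<Sum>a\<leftarrow>as. f a) = (\<Sum>a\<leftarrow>as. Im (f a))"
  by (induction as) auto

text \<open>The operator sends \<open>f\<close> to \<open>\<alpha> f + \<beta> t f'\<close>. Off the
  real line its value may be divided by \<open>f(z)\<close>, which is nonzero, and
  \<open>f'/f\<close> becomes the sum of the \<open>1 / (z - a)\<close>.\<close>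

lemma n_sequence_nonreal_criterion:
  assumes "\<And>as z. length as \<le> n \<Longrightarrow> z \<notin> \<real> \<Longrightarrow>
    complex_of_real \<alpha> + complex_of_real \<beta> * z * (\<Sum>a\<leftarrow>as. 1 / (z - complex_of_real a)) \<noteq> 0"
  shows "n_sequence n (\<lambda>k. \<alpha> + \<beta> * real k)"
  unfolding n_sequence_def
proof (intro allI impI)
  fix f assume deg: "degree f \<le> n" and f: "only_real_zeros f"
  have op: "diag_op n (\<lambda>k. \<alpha> + \<beta> * real k) f = smult \<alpha> f + smult \<beta> (pCons 0 (pderiv f))"
    (is "_ = ?g")
    using deg
    by (intro poly_eqI)
       (auto simp: coeff_diag_op coeff_pderiv coeff_pCons algebra_simps coeff_eq_0
             split: nat.split)
  show "only_real_zeros (diag_op n (\<lambda>k. \<alpha> + \<beta> * real k) f)"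
  proof (cases "f = 0")
    case False
    then obtain c as where c: "c \<noteq> 0" and fc: "f = smult c (\<Prod>a\<leftarrow>as. [:-a, 1:])"
      using only_real_zeros_splits f by blast
    have len: "length as \<le> n"
      using deg c degree_prod_list_linear[of as] by (simp add: fc)
    have "poly (map_poly complex_of_real ?g) z \<noteq> 0" if z: "z \<notin> \<real>" for z
    proof -
      let ?F = "map_poly complex_of_real (\<Prod>a\<leftarrow>as. [:-a, 1:])"
      have "poly (map_poly complex_of_real ?g) z = complex_of_real c * poly ?F z *
          (complex_of_real \<alpha> + complex_of_real \<beta> * z * (\<Sum>a\<leftarrow>as. 1 / (z - complex_of_real a)))"
        using poly_pderiv_prod_list_linear[OF z, of as]
        by (simp add: fc map_poly_of_real_simps map_poly_pCons pderiv_smult algebra_simps)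
      then show ?thesis
        using assms[OF len z] c poly_prod_list_linear_nonreal[OF z, of as] by simp
    qed
    then show ?thesis
      unfolding op only_real_zeros_def by blast
  qed (simp add: diag_op_def only_real_zeros_def)
qed

lemma nonreal_imp_cmod_diff_pos:
  assumes "z \<notin> \<real>"
  shows "(Re z - a)\<^sup>2 + (Im z)\<^sup>2 > 0"
  using assms by (simp add: complex_is_Real_iff sum_power2_gt_zero_iff)

lemma n_sequence_plus:
  assumes "s > 0"
  shows "n_sequence n (\<lambda>k. real k + s)"
proof -
  \<comment> \<open>After division by \<open>z\<close>, all summands have imaginary part of the sign opposite to \<open>Im z\<close>.\<close>
  have "n_sequence n (\<lambda>k. s + 1 * real k)"
  proof (rule n_sequence_nonreal_criterion)
    fix as :: "real list" and z :: complex
    assume z: "z \<notin> \<real>"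
    then have z0: "z \<noteq> 0" and im: "Im z \<noteq> 0"
      by (auto simp: complex_is_Real_iff)
    let ?S = "\<Sum>a\<leftarrow>as. 1 / (z - complex_of_real a)"
    have "Im ?S = - Im z * (\<Sum>a\<leftarrow>as. 1 / ((Re z - a)\<^sup>2 + (Im z)\<^sup>2))"
      unfolding Im_sum_list sum_list_const_mult[symmetric] by (simp add: Im_divide)
    moreover have "Im (complex_of_real s / z) = - Im z * (s / ((Re z)\<^sup>2 + (Im z)\<^sup>2))"
      by (simp add: Im_divide)
    ultimately have "Im (complex_of_real s / z + ?S) = - Im z *
        (s / ((Re z)\<^sup>2 + (Im z)\<^sup>2) + (\<Sum>a\<leftarrow>as. 1 / ((Re z - a)\<^sup>2 + (Im z)\<^sup>2)))"
      by (simp add: algebra_simps)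
    moreover have "s / ((Re z)\<^sup>2 + (Im z)\<^sup>2) > 0"
      using assms nonreal_imp_cmod_diff_pos[OF z, of 0] by simp
    moreover have "(\<Sum>a\<leftarrow>as. 1 / ((Re z - a)\<^sup>2 + (Im z)\<^sup>2)) \<ge> 0"
      by (intro sum_list_nonneg) auto
    ultimately have "Im (complex_of_real s / z + ?S) \<noteq> 0"
      using im by simp
    then have "z * (complex_of_real s / z + ?S) \<noteq> 0"
      using z0 by (metis mult_eq_0_iff zero_complex.sel(2))
    then show "complex_of_real s + complex_of_real 1 * z * ?S \<noteq> 0"
      using z0 by (simp add: algebra_simps)
  qed
  then show ?thesis
    by (simp add: add.commute)
qed

lemma n_sequence_minus:
  assumes "t > real n"
  shows "n_sequence n (\<lambda>k. t - real k)"
proof -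
  \<comment> \<open>After multiplication by \<open>z\<close>, all summands have imaginary part of the sign of \<open>Im z\<close>.\<close>
  have "n_sequence n (\<lambda>k. t + (-1) * real k)"
  proof (rule n_sequence_nonreal_criterion)
    fix as :: "real list" and z :: complex
    assume len: "length as \<le> n" and z: "z \<notin> \<real>"
    then have im: "Im z \<noteq> 0"
      by (auto simp: complex_is_Real_iff)
    let ?S = "\<lambda>as. \<Sum>a\<leftarrow>as. 1 / (z - complex_of_real a)"
    let ?E = "\<lambda>as t. complex_of_real t + complex_of_real (-1) * z * ?S as"
    \<comment> \<open>Each root uses up one unit of \<open>t\<close>, so the induction hypothesis is
      taken at \<open>t - 1\<close>. What remains of its contribution is
      \<open>- a z / (z - a)\<close>, with imaginary part
      \<open>Im z * a\<^sup>2 / |z - a|\<^sup>2\<close>. With at most \<open>n < t\<close> roots the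
      bracket stays positive.\<close>
    have Im_eq: "Im (z * ?E as t) = Im z *
        (t - real (length as) + (\<Sum>a\<leftarrow>as. a\<^sup>2 / ((Re z - a)\<^sup>2 + (Im z)\<^sup>2)))" for t
    proof (induction as arbitrary: t)
      case (Cons a as)
      have nz: "z - complex_of_real a \<noteq> 0"
        using z by auto
      have "z * ?E (a # as) t = z * ?E as (t - 1) + z * (1 - z / (z - complex_of_real a))"
        by (simp add: algebra_simps)
      also have "z * (1 - z / (z - complex_of_real a)) =
          - (complex_of_real a * z / (z - complex_of_real a))"
        using nz by (simp add: field_simps)
      also have "Im (z * ?E as (t - 1) + \<dots>) = Im (z * ?E as (t - 1)) +
          Im z * (a\<^sup>2 / ((Re z - a)\<^sup>2 + (Im z)\<^sup>2))"
        by (simp add: Im_divide power2_eq_square algebra_simps)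
      finally show ?case
        unfolding Cons by (simp add: algebra_simps)
    qed simp
    have "(\<Sum>a\<leftarrow>as. a\<^sup>2 / ((Re z - a)\<^sup>2 + (Im z)\<^sup>2)) \<ge> 0"
      by (intro sum_list_nonneg) auto
    then have "Im (z * ?E as t) \<noteq> 0"
      unfolding Im_eq using im assms len by simp
    then show "?E as t \<noteq> 0"
      by (metis mult_zero_right zero_complex.sel(2))
  qed
  then show ?thesis
    by simp
qed

text \<open>The operators compose, and the inner image still has degree at most
  \<open>n\<close>.\<close>

lemma n_sequence_mult:
  assumes "n_sequence n \<gamma>" and "n_sequence n \<delta>"
  shows "n_sequence n (\<lambda>k. \<gamma> k * \<delta> k)"
proof -
  have "diag_op n (\<lambda>k. \<gamma> k * \<delta> k) f = diag_op n \<gamma> (diag_op n \<delta> f)" for f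
    by (rule poly_eqI) (simp add: coeff_diag_op)
  moreover have "degree (diag_op n \<delta> f) \<le> n" for f
    by (rule degree_le) (simp add: coeff_diag_op)
  ultimately show ?thesis
    using assms by (simp add: n_sequence_def)
qed

lemma n_sequence_const: "n_sequence n (\<lambda>k. c)"
proof -
  have "diag_op n (\<lambda>k. c) f = smult c f" if "degree f \<le> n" for f
    using that by (intro poly_eqI) (auto simp: coeff_diag_op coeff_eq_0)
  then show ?thesis
    by (auto simp: n_sequence_def only_real_zeros_def map_poly_of_real_simps)
qed

lemma n_sequence_quadratic:
  assumes "r > 0"
  shows "n_sequence n (\<lambda>k. real k * (real n - real k) + r)"
proof -
  \<comment> \<open>\<open>t\<close> is the positive root of \<open>X\<^sup>2 - n X - r\<close> and
    \<open>n - t\<close> the other one; they give the two linear factors.\<close>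
  define w where "w = sqrt ((real n)\<^sup>2 + 4 * r)"
  define t where "t = (real n + w) / 2"
  have w2: "w\<^sup>2 = (real n)\<^sup>2 + 4 * r"
    using assms by (simp add: w_def)
  have "real n < w"
    using assms unfolding w_def by (intro real_less_rsqrt) simp
  then have t: "t > real n"
    by (simp add: t_def)
  have "t * (t - real n) = r"
    using w2 by (simp add: t_def field_simps power2_eq_square)
  then have "real k * (real n - real k) + r = (real k + (t - real n)) * (t - real k)" for k
    by (simp add: algebra_simps)
  then show ?thesis
    using n_sequence_mult[OF n_sequence_plus[of "t - real n" n] n_sequence_minus[OF t]] t by simp
qed

lemma n_sequence_poly_negative_roots:
  assumes "\<forall>r\<in>set rs. r < 0"
  shows "n_sequence n (\<lambda>k. poly (smult c (\<Prod>r\<leftarrow>rs. [:-r, 1:])) (real k * (real n - real k)))"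
  using assms
proof (induction rs)
  case Nil
  then show ?case
    using n_sequence_const by simp
next
  case (Cons r rs)
  have "n_sequence n (\<lambda>k. (real k * (real n - real k) + - r) *
      poly (smult c (\<Prod>r\<leftarrow>rs. [:-r, 1:])) (real k * (real n - real k)))"
    using Cons by (intro n_sequence_mult n_sequence_quadratic) auto
  then show ?case
    by (simp add: algebra_simps)
qed

section \<open>Real polynomials\<close>

lemma prod_list_linear_dvd:
  fixes q :: "real poly"
  assumes "distinct rs" and "\<forall>r\<in>set rs. poly q r = 0"
  shows "(\<Prod>r\<leftarrow>rs. [:-r, 1:]) dvd q"
  using assms
proof (induction rs arbitrary: q)
  case (Cons r rs)
  then obtain p where p: "q = [:-r, 1:] * p"
    by (auto simp: poly_eq_0_iff_dvd elim: dvdE)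
  have "(\<Prod>r\<leftarrow>rs. [:-r, 1:]) dvd p"
  proof (rule Cons.IH)
    show "\<forall>x\<in>set rs. poly p x = 0"
    proof
      fix x assume "x \<in> set rs"
      with Cons.prems have "x \<noteq> r" "poly q x = 0"
        by auto
      then show "poly p x = 0"
        by (simp add: p)
    qed
  qed (use Cons.prems in auto)
  then show ?case
    unfolding p by (simp add: mult_dvd_mono del: mult_pCons_left)
qed simp

text \<open>One root may be missing from \<open>R\<close>: it is then real, and the signs of the leading and of the
  constant coefficient make it negative.\<close>

lemma splits_over_negative_reals:
  fixes q :: "real poly"
  assumes "finite R" and "\<And>r. r \<in> R \<Longrightarrow> r < 0 \<and> poly q r = 0"
    and "degree q \<le> Suc (card R)" and "lead_coeff q > 0" and "poly q 0 > 0"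
  obtains c rs where "\<forall>r\<in>set rs. r < 0" and "q = smult c (\<Prod>r\<leftarrow>rs. [:-r, 1:])"
proof -
  obtain rs where rs: "set rs = R" "distinct rs"
    using finite_distinct_list[OF assms(1)] by blast
  define P where "P = (\<Prod>r\<leftarrow>rs. [:-r, 1:])"
  have neg: "\<forall>r\<in>set rs. r < 0"
    using assms(2) rs by auto
  have degP: "degree P = card R"
    unfolding P_def degree_prod_list_linear using rs by (metis distinct_card)
  have "P dvd q"
    unfolding P_def using assms(2) rs by (intro prod_list_linear_dvd) auto
  then obtain s where s: "q = P * s"
    by (auto elim: dvdE)
  have nz: "P \<noteq> 0" "s \<noteq> 0"
    using assms(5) s by auto
  then have "degree s \<le> 1"
    using assms(3) degP unfolding s by (simp add: degree_mult_eq)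
  then have "s = [:coeff s 0, coeff s 1:]"
    by (intro poly_eqI) (auto simp: coeff_pCons coeff_eq_0 split: nat.split)
  then obtain a c where ac: "s = [:a, c:]"
    by blast
  \<comment> \<open>Since \<open>P\<close> is monic and positive at 0, the signs of \<open>q\<close>
    pass to its cofactor \<open>a + c X\<close>: \<open>a > 0\<close>, and either
    \<open>c = 0\<close> or the missing root is \<open>- a / c < 0\<close>.\<close>
  have leadP: "lead_coeff P = 1"
    unfolding P_def
  proof (induction rs)
    case (Cons r rs)
    then show ?case
      using lead_coeff_mult[of "[:-r, 1:]" "\<Prod>r\<leftarrow>rs. [:-r, 1:]"]
      by (simp del: mult_pCons_left)
  qed simp
  have P0: "poly P 0 > 0"
    unfolding P_def using neg by (induction rs) (auto simp: mult_neg_pos)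
  have a: "a > 0"
    using assms(5) P0 unfolding s ac by (simp add: zero_less_mult_iff)
  show ?thesis
  proof (cases "c = 0")
    case True
    then show ?thesis
      using that[of rs a] neg by (simp add: s ac P_def)
  next
    case False
    then have "c > 0"
      using assms(4) leadP unfolding s ac lead_coeff_mult by simp
    moreover have s': "s = smult c [:- (- a / c), 1:]"
      using False by (simp add: ac)
    have "q = smult c (\<Prod>r\<leftarrow>(- a / c) # rs. [:-r, 1:])"
      unfolding s s' P_def list.map prod_list.Cons mult_smult_right by (simp only: mult.commute)
    ultimately show ?thesis
      using that[of "(- a / c) # rs" c] neg a by simp
  qed
qed

text \<open>Induction on the degree: \<open>B\<close> takes the same value \<open>c\<close> at the
  distinct points 0 and \<open>D\<close>, so \<open>B - c\<close> is divisible by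
  \<open>X (D - X)\<close>. That factor is itself invariant, hence so is the quotient.\<close>

lemma pcompose_reflection_invariant:
  fixes B :: "real poly"
  assumes "D \<noteq> 0" and "pcompose B [:D, -1:] = B"
  obtains q where "B = pcompose q [:0, D, -1:]"
proof -
  have "\<exists>q. B = pcompose q [:0, D, -1:]"
    using assms(2)
  proof (induction "degree B" arbitrary: B rule: less_induct)
    case less
    show ?case
    proof (cases "degree B = 0")
      case True
      then obtain c where "B = [:c:]"
        by (metis degree_eq_zeroE)
      then show ?thesis
        by (intro exI[of _ "[:c:]"]) simp
    next
      case False
      define c where "c = poly B 0"
      have "poly B D = poly (pcompose B [:D, -1:]) D"
        using less.prems by simp
      also have "\<dots> = c"
        by (simp add: poly_pcompose c_def)
      finally have "poly B D = c" .
      then have "(\<Prod>r\<leftarrow>[0, D]. [:-r, 1:]) dvd B - [:c:]"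
        using assms(1) by (intro prod_list_linear_dvd) (auto simp: c_def)
      then obtain C where "B - [:c:] = (\<Prod>r\<leftarrow>[0, D]. [:-r, 1:]) * C"
        by (auto elim: dvdE)
      then have "B - [:c:] = [:0, D, -1:] * (- C)"
        by simp
      then obtain C where C: "B = [:c:] + [:0, D, -1:] * C"
        by (metis add.commute diff_add_cancel)
      have "C \<noteq> 0"
        using False C by auto
      then have "degree ([:0, D, -1:] * C) = Suc (Suc (degree C))"
        by (subst degree_mult_eq) auto
      then have deg: "degree C < degree B"
        unfolding C by (subst degree_add_eq_right) auto
      have "pcompose [:0, D, -1:] [:D, -1:] = [:0, D, -1:]"
        by (simp add: pcompose_pCons)
      then have "[:0, D, -1:] * pcompose C [:D, -1:] = [:0, D, -1:] * C"
        using less.prems unfolding C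
        by (simp add: pcompose_add pcompose_mult pcompose_const del: mult_pCons_left)
      then have "pcompose C [:D, -1:] = C"
        by (subst (asm) mult_left_cancel) auto
      then obtain q where "C = pcompose q [:0, D, -1:]"
        using less.hyps deg by blast
      then have "B = pcompose (pCons c q) [:0, D, -1:]"
        by (simp add: C pcompose_pCons)
      then show ?thesis ..
    qed
  qed
  then show ?thesis
    using that by blast
qed

section \<open>Binomial coefficients as polynomials in the upper entry\<close>

definition gbinomial_poly :: "real poly \<Rightarrow> nat \<Rightarrow> real poly" where
  "gbinomial_poly p h = smult (1 / fact h) (\<Prod>j<h. p - [:real j:])"

lemma poly_gbinomial_poly: "poly (gbinomial_poly p h) x = poly p x gchoose h"
  by (simp add: gbinomial_poly_def poly_prod gbinomial_prod_rev atLeast0LessThan)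

lemma degree_gbinomial_poly:
  assumes "c \<noteq> 0"
  shows "degree (gbinomial_poly [:a, c:] h) = h"
  using assms by (simp add: gbinomial_poly_def degree_prod_sum_eq)

lemma lead_coeff_gbinomial_poly:
  assumes "c \<noteq> 0"
  shows "lead_coeff (gbinomial_poly [:a, c:] h) = c ^ h / fact h"
  using assms unfolding gbinomial_poly_def lead_coeff_smult lead_coeff_prod by simp

section \<open>The values of \<open>b\<close> off the interval\<close>

text \<open>The upper entries are those of \<open>b\<close> negated: the first is a natural number
  at \<open>-k\<close>, the second at \<open>d + k\<close> for \<open>k > 0\<close>, as
  Vandermonde's identity requires.\<close>

definition b_poly :: "nat \<Rightarrow> real \<Rightarrow> real poly" where
  "b_poly m d = (\<Sum>h<m. [:1 / (real h + 1), 1 / real m - 1 / (real h + 1):] *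
     (gbinomial_poly [:0, -1:] h * gbinomial_poly [:- d - 1, 1:] h))"

lemma poly_b_poly:
  "poly (b_poly m d) x = (\<Sum>h<m. (x / real m + (1 - x) / (real h + 1)) *
     ((- x gchoose h) * (x - d - 1 gchoose h)))"
  by (simp add: b_poly_def poly_sum poly_gbinomial_poly algebra_simps diff_divide_distrib)

lemma b_eq_poly_b_poly:
  assumes "m > 0"
  shows "b m d i = poly (b_poly m (real d)) (real i)"
proof -
  \<comment> \<open>Negating both upper entries produces the sign \<open>(-1)^h\<close>
    twice.\<close>
  have "(real i - 1 + real h gchoose h) * (real d - real i + real h gchoose h) =
      (- real i gchoose h) * (real i - real d - 1 gchoose h)" for h
    using gbinomial_negated_upper[of "- real i" h] gbinomial_negated_upper[of "real i - real d - 1" h]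
    by (simp add: algebra_simps)
  moreover have "(real i * (real h - real m + 1) + real m) / ((real h + 1) * real m) =
      real i / real m + (1 - real i) / (real h + 1)" for h
    using assms by (simp add: field_simps)
  moreover have "{0..m - 1} = {..<m}"
    using assms by auto
  ultimately show ?thesis
    by (simp add: b_def poly_b_poly mult.assoc)
qed

lemma
  assumes "m > 0"
  shows degree_b_poly: "degree (b_poly m d) = 2 * (m - 1)"
    and lead_coeff_b_poly: "(-1) ^ (m - 1) * lead_coeff (b_poly m d) > 0"
proof -
  obtain n where m: "m = Suc n"
    using assms by (cases m) auto
  define T where "T h = [:1 / (real h + 1), 1 / real m - 1 / (real h + 1):] *
     (gbinomial_poly [:0, -1:] h * gbinomial_poly [:- d - 1, 1:] h)" for h
  define G where "G = gbinomial_poly [:0, -1:] n * gbinomial_poly [:- d - 1, 1:] n"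
  have nz: "gbinomial_poly [:a, c:] h \<noteq> 0" if "c \<noteq> 0" for a c h
    using lead_coeff_gbinomial_poly[OF that, of a h] that by auto
  have degU: "degree (gbinomial_poly [:0, -1:] h * gbinomial_poly [:- d - 1, 1:] h) = 2 * h" for h
    by (simp add: degree_mult_eq nz degree_gbinomial_poly)
  \<comment> \<open>In the top summand \<open>h + 1 = m\<close>, so the linear coefficient
    \<open>1 / m - 1 / (h + 1)\<close> vanishes. The degree is thus \<open>2 n\<close>, still above
    the at most \<open>2 h + 1\<close> of the others.\<close>
  have Tn: "T n = smult (1 / real m) G"
    by (simp add: T_def G_def m add.commute)
  then have degTn: "degree (T n) = 2 * n"
    using degU[of n] m by (simp add: G_def)
  have "lead_coeff G = (-1) ^ n / (fact n * fact n)"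
    unfolding G_def lead_coeff_mult by (simp add: lead_coeff_gbinomial_poly)
  then have leadTn: "lead_coeff (T n) = (-1) ^ n / (real m * (fact n * fact n))"
    unfolding Tn lead_coeff_smult by simp
  have sum: "b_poly m d = (\<Sum>h<n. T h) + T n"
    by (simp add: b_poly_def T_def m)
  have degT: "degree (T h) < 2 * n" if "h < n" for h
  proof -
    have "degree (T h) \<le> 1 + 2 * h"
      unfolding T_def using degU[of h]
      by (intro order.trans[OF degree_mult_le]) (auto intro: order.trans[OF degree_pCons_le])
    then show ?thesis
      using that by simp
  qed
  have "degree (b_poly m d) = 2 * n \<and> lead_coeff (b_poly m d) = lead_coeff (T n)"
  proof (cases "n = 0")
    case True
    then show ?thesis
      using degTn by (simp add: sum)
  next
    case False
    then have "degree (\<Sum>h<n. T h) < degree (T n)"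
      unfolding degTn by (intro degree_sum_less) (use degT in auto)
    then show ?thesis
      using degTn by (simp add: sum degree_add_eq_right coeff_eq_0)
  qed
  then show "degree (b_poly m d) = 2 * (m - 1)" "(-1) ^ (m - 1) * lead_coeff (b_poly m d) > 0"
    by (auto simp: leadTn m simp flip: power_mult_distrib)
qed

text \<open>Terms with \<open>h > k\<close> vanish, and the symmetry
  \<open>h \<mapsto> k - h\<close> gives Vandermonde's sum. For the weight
  \<open>1 / (h + 1)\<close>, absorption first replaces \<open>k\<close> by \<open>k + 1\<close> in
  the upper entry.\<close>

lemma Vandermonde_truncated:
  fixes a :: real
  assumes "k < m"
  shows "(\<Sum>h<m. (real k gchoose h) * (a gchoose h)) = (a + real k gchoose k)"
    and "(\<Sum>h<m. (real k gchoose h) * (a gchoose h) / (real h + 1)) =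
      (a + real k + 1 gchoose k) / (real k + 1)"
proof -
  have zero: "real k gchoose h = 0" if "h > k" for h
    using that by (simp flip: binomial_gbinomial)
  have "(\<Sum>h<m. (real k gchoose h) * (a gchoose h)) = (\<Sum>h=0..k. (real k gchoose h) * (a gchoose h))"
    using assms zero by (intro sum.mono_neutral_right) auto
  also have "\<dots> = (\<Sum>h=0..k. (a gchoose h) * (real k gchoose (k - h)))"
    by (intro sum.cong refl) (metis atLeastAtMost_iff gbinomial_of_nat_symmetric mult.commute)
  finally show "(\<Sum>h<m. (real k gchoose h) * (a gchoose h)) = (a + real k gchoose k)"
    by (simp add: gbinomial_Vandermonde)
  have abs: "(real k gchoose h) / (real h + 1) = (real (Suc k) gchoose (k - h)) / (real k + 1)"
    if "h \<le> k" for h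
  proof -
    have "real (Suc k) gchoose (k - h) = real (Suc k) gchoose Suc h"
      using gbinomial_of_nat_symmetric[of "Suc h" "Suc k", where 'a = real] that by simp
    moreover have "real (Suc h) * (real (Suc k) gchoose Suc h) = real (Suc k) * (real k gchoose h)"
      using gbinomial_absorption[of h "real (Suc k)"] by simp
    ultimately show ?thesis
      by (simp add: field_simps)
  qed
  have "(\<Sum>h<m. (real k gchoose h) * (a gchoose h) / (real h + 1)) =
      (\<Sum>h=0..k. (real k gchoose h) * (a gchoose h) / (real h + 1))"
    using assms zero by (intro sum.mono_neutral_right) auto
  also have "\<dots> = (\<Sum>h=0..k. (a gchoose h) * (real (Suc k) gchoose (k - h)) / (real k + 1))"
  proof (intro sum.cong refl)
    fix h assume "h \<in> {0..k}"
    then show "(real k gchoose h) * (a gchoose h) / (real h + 1) =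
        (a gchoose h) * (real (Suc k) gchoose (k - h)) / (real k + 1)"
      using abs[of h] by (metis atLeastAtMost_iff mult.commute times_divide_eq_right)
  qed
  also have "\<dots> = (\<Sum>h=0..k. (a gchoose h) * (real (Suc k) gchoose (k - h))) / (real k + 1)"
    by (simp add: sum_divide_distrib)
  also have "\<dots> = (a + real (Suc k) gchoose k) / (real k + 1)"
    by (simp only: gbinomial_Vandermonde)
  finally show "(\<Sum>h<m. (real k gchoose h) * (a gchoose h) / (real h + 1)) =
      (a + real k + 1 gchoose k) / (real k + 1)"
    by (simp add: algebra_simps)
qed

lemma poly_b_poly_neg:
  assumes "k < m"
  shows "poly (b_poly m d) (- real k) =
    (- d gchoose k) - real k / real m * (- d - 1 gchoose k)"
proof -
  \<comment> \<open>Adding \<open>k\<close> and \<open>k + 1\<close> to \<open>?a\<close> gives the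
    upper entries \<open>- d - 1\<close> and \<open>- d\<close>; the factor \<open>1 + k\<close>
    cancels the denominator.\<close>
  let ?a = "- real k - d - 1"
  have "poly (b_poly m d) (- real k) =
      - real k / real m * (\<Sum>h<m. (real k gchoose h) * (?a gchoose h)) +
      (1 + real k) * (\<Sum>h<m. (real k gchoose h) * (?a gchoose h) / (real h + 1))"
    unfolding poly_b_poly sum_distrib_left sum.distrib[symmetric]
    by (intro sum.cong) (auto simp: algebra_simps)
  then show ?thesis
    using Vandermonde_truncated[OF assms, of ?a] by (simp add: add.commute[of 1])
qed

lemma poly_b_poly_above:
  assumes "0 < k" and "k < m"
  shows "poly (b_poly m d) (d + real k) =
    (- d gchoose k) - real k / real m * (- d - 1 gchoose k)"
proof -
  obtain j where k: "k = Suc j"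
    using assms by (cases k) auto
  \<comment> \<open>The natural upper entry is now \<open>j = k - 1\<close>, so Vandermonde yields
    lower index \<open>j\<close>; the prefactors \<open>d + k\<close> and \<open>1 - d - k\<close>
    raise it to \<open>k\<close>.\<close>
  let ?a = "- (d + real k)"
  have "poly (b_poly m d) (d + real k) =
      (d + real k) / real m * (\<Sum>h<m. (real j gchoose h) * (?a gchoose h)) +
      (1 - d - real k) * (\<Sum>h<m. (real j gchoose h) * (?a gchoose h) / (real h + 1))"
    unfolding poly_b_poly sum_distrib_left sum.distrib[symmetric]
    by (intro sum.cong) (auto simp: algebra_simps k)
  also have "\<dots> = (d + real k) / real m * (- d - 1 gchoose j) +
      (1 - d - real k) * ((- d gchoose j) / (real j + 1))"
    using Vandermonde_truncated[of j m ?a] assms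
    by (simp add: k minus_diff_commute diff_diff_eq add.commute)
  also have "(1 - d - real k) * ((- d gchoose j) / (real j + 1)) = - d gchoose k"
    using gbinomial_mult_1[of "- d" j] by (simp add: k field_simps)
  also have "(d + real k) / real m * (- d - 1 gchoose j) =
      - (real k / real m * (- d - 1 gchoose k))"
  proof -
    have "(d + real k) * (- d - 1 gchoose j) = - (real k * (- d - 1 gchoose k))"
      using gbinomial_mult_1[of "- d - 1" j] by (simp add: k algebra_simps)
    then show ?thesis
      by (simp add: field_simps)
  qed
  finally show ?thesis
    by simp
qed

text \<open>Both sides have degree \<open>2 (m - 1)\<close> and agree at \<open>2 m - 1\<close>
  points: the pairs \<open>-k\<close>, \<open>d + k\<close> swapped by the reflection, and its fixed
  point \<open>d / 2\<close>.\<close>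

lemma b_poly_reflection:
  assumes "d > 0" and "m > 0"
  shows "pcompose (b_poly m d) [:d, -1:] = b_poly m d"
proof (rule poly_eqI_degree)
  define A where "A = (\<lambda>k. - real k) ` {1..<m}"
  define B where "B = (\<lambda>k. d + real k) ` {1..<m}"
  have ends: "poly (b_poly m d) (- real k) = poly (b_poly m d) (d + real k)" if "0 < k" "k < m" for k
    using that by (simp add: poly_b_poly_neg poly_b_poly_above)
  show "poly (pcompose (b_poly m d) [:d, -1:]) x = poly (b_poly m d) x"
    if "x \<in> insert (d / 2) (A \<union> B)" for x
    using that ends by (auto simp: A_def B_def poly_pcompose)
  have "card A = m - 1" "card B = m - 1"
    by (simp_all add: A_def B_def card_image inj_on_def)
  moreover have "A \<inter> B = {}"
    using assms(1) by (auto simp: A_def B_def)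
  moreover have "finite A" "finite B" "d / 2 \<notin> A \<union> B"
    using assms(1) by (auto simp: A_def B_def)
  ultimately have card: "card (insert (d / 2) (A \<union> B)) = Suc (2 * (m - 1))"
    by (simp add: card_Un_disjoint)
  show "degree (b_poly m d) < card (insert (d / 2) (A \<union> B))"
    using assms(2) by (simp add: card degree_b_poly)
  then show "degree (pcompose (b_poly m d) [:d, -1:]) < card (insert (d / 2) (A \<union> B))"
    by (simp add: degree_pcompose)
qed

lemma poly_b_poly_neg_sign:
  assumes "k < m" and "d > 0"
  obtains A where "A > 0"
    and "poly (b_poly m d) (- real k) = (-1) ^ k * A * (real m * d - real k * (d + real k))"
proof
  \<comment> \<open>Both binomials are \<open>(-1)^k\<close> times multiples of
    \<open>pochhammer d k\<close>, since
    \<open>pochhammer (d + 1) k = (d + k) / d * pochhammer d k\<close>; \<open>A\<close> is the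
    common factor once \<open>m d\<close> is cleared.\<close>
  define A where "A = pochhammer d k / (fact k * (real m * d))"
  show "A > 0"
    using assms by (simp add: A_def pochhammer_pos)
  have "d * pochhammer (d + 1) k = (d + real k) * pochhammer d k"
    using pochhammer_rec[of d k] pochhammer_rec'[of d k] by simp
  then have poch: "pochhammer (d + 1) k = (d + real k) * pochhammer d k / d"
    using assms by (simp add: field_simps)
  have "poly (b_poly m d) (- real k) = (-1) ^ k * (pochhammer d k / fact k) -
      real k / real m * ((-1) ^ k * (pochhammer (d + 1) k / fact k))"
    by (simp add: poly_b_poly_neg[OF assms(1)] gbinomial_pochhammer add.commute)
  also have "\<dots> = (-1) ^ k * A * (real m * d - real k * (d + real k))"
    using assms unfolding poch by (simp add: A_def field_simps)
  finally show "poly (b_poly m d) (- real k) = (-1) ^ k * A * (real m * d - real k * (d + real k))" .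
qed

section \<open>Factorisation of \<open>b\<close>\<close>

lemma b_poly_splits:
  assumes "d > 0" and "m > 0"
  obtains c rs where "\<forall>r\<in>set rs. r < 0"
    and "b_poly m d = pcompose (smult c (\<Prod>r\<leftarrow>rs. [:-r, 1:])) [:0, d, -1:]"
proof -
  obtain q where q: "b_poly m d = pcompose q [:0, d, -1:]"
    using pcompose_reflection_invariant b_poly_reflection assms by (metis less_irrefl)
  have deg: "degree q = m - 1"
    using degree_b_poly[OF assms(2), of d] by (simp add: q degree_pcompose)
  \<comment> \<open>The inner polynomial has leading coefficient \<open>-1\<close>, which accounts
    for the sign.\<close>
  have "lead_coeff (b_poly m d) = lead_coeff q * (-1) ^ (m - 1)"
    unfolding q by (subst lead_coeff_comp) (simp_all add: deg)
  then have "(-1) ^ (m - 1) * lead_coeff (b_poly m d) = lead_coeff q"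
    by (simp add: left_minus_one_mult_self mult.commute)
  then have lead: "lead_coeff q > 0"
    using lead_coeff_b_poly[OF assms(2), of d] by simp
  \<comment> \<open>\<open>x k\<close> is the value of \<open>X (d - X)\<close> at
    \<open>-k\<close>. It decreases strictly in \<open>k\<close>, hence so does the sign factor
    \<open>g\<close>.\<close>
  define x where "x k = - real k * (d + real k)" for k
  define g where "g k = real m * d + x k" for k
  have poly_q: "poly q (x k) = poly (b_poly m d) (- real k)" for k
    by (simp add: q poly_pcompose x_def algebra_simps)
  have q0: "poly q 0 = 1"
    using poly_q[of 0] poly_b_poly_neg[of 0 m d] assms(2) by (simp add: x_def)
  have sign: "\<exists>A>0. poly q (x k) = (-1) ^ k * A * g k" if "k < m" for k
    using poly_b_poly_neg_sign[OF that assms(1)] unfolding poly_q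
    by (metis g_def x_def mult_minus_left diff_conv_add_uminus)
  have x_less: "x k < x j" if "j < k" for j k
    using that assms(1) unfolding x_def
    by (simp add: mult_strict_mono)
  have x_le: "x k \<le> x j" if "j \<le> k" for j k
    using that x_less[of j k] by (cases "j = k") auto
  \<comment> \<open>\<open>E\<close> has at most one element: the index where the sign alternation of \<open>q\<close> breaks.\<close>
  define E where "E = {k. g k > 0 \<and> g (Suc k) \<le> 0}"
  \<comment> \<open>Half-open intervals are disjoint, so roots from different \<open>k\<close> are
    distinct; a root at \<open>x k\<close> itself (\<open>g k = 0\<close>) is counted in the
    interval below it.\<close>
  have "\<exists>r. x (Suc k) < r \<and> r \<le> x k \<and> poly q r = 0" if k: "Suc k < m" "k \<notin> E" for k
  proof (cases "g k = 0")
    case True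
    then have "poly q (x k) = 0"
      using sign[of k] k by auto
    then show ?thesis
      using x_less[of k "Suc k"] by auto
  next
    case False
    obtain A where A: "A > 0" "poly q (x k) = (-1) ^ k * A * g k"
      using sign[of k] k by auto
    obtain A' where A': "A' > 0" "poly q (x (Suc k)) = (-1) ^ Suc k * A' * g (Suc k)"
      using sign[OF k(1)] by blast
    have "g (Suc k) < g k"
      using x_less[of k "Suc k"] by (simp add: g_def)
    \<comment> \<open>Outside \<open>E\<close> the decreasing \<open>g\<close> keeps its sign here,
      so the factors \<open>(-1)^k\<close> make \<open>q\<close> change sign.\<close>
    then have "g k * g (Suc k) > 0"
      using False k by (auto simp: E_def zero_less_mult_iff)
    moreover have "poly q (x (Suc k)) * poly q (x k) = - (A * A' * (g k * g (Suc k)))"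
      unfolding A A' by (simp flip: power_mult_distrib)
    ultimately have "poly q (x (Suc k)) * poly q (x k) < 0"
      using A(1) A'(1) by (simp only: neg_less_0_iff_less zero_less_mult_iff) simp
    then show ?thesis
      using poly_IVT[OF x_less[of k "Suc k"]] by (metis lessI less_imp_le)
  qed
  then obtain \<rho> where \<rho>: "\<And>k. Suc k < m \<Longrightarrow> k \<notin> E \<Longrightarrow>
      x (Suc k) < \<rho> k \<and> \<rho> k \<le> x k \<and> poly q (\<rho> k) = 0"
    by metis
  define K where "K = {..<m - 1} - E"
  have K: "Suc k < m" "k \<notin> E" if "k \<in> K" for k
    using that by (auto simp: K_def)
  have "\<rho> k < \<rho> j" if "j \<in> K" "k \<in> K" "j < k" for j k
    using \<rho>[of j] \<rho>[of k] K that x_le[of "Suc j" k] by fastforce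
  then have "inj_on \<rho> K"
    by (intro linorder_inj_onI) force+
  then have "card (\<rho> ` K) = card K"
    by (rule card_image)
  moreover have "m - 1 \<le> Suc (card K)"
  proof -
    have "j = k" if "j \<in> E" "k \<in> E" for j k
      using that x_le[of "Suc j" k] x_le[of "Suc k" j]
      by (cases j k rule: linorder_cases) (auto simp: E_def g_def)
    then have "E = {} \<or> (\<exists>k. E = {k})"
      by blast
    then show ?thesis
      by (auto simp: K_def card_Diff_singleton_if)
  qed
  ultimately have card: "degree q \<le> Suc (card (\<rho> ` K))"
    by (simp add: deg)
  have roots: "r < 0 \<and> poly q r = 0" if r: "r \<in> \<rho> ` K" for r
  proof -
    obtain k where "k \<in> K" "r = \<rho> k"
      using r by auto
    then have "r \<le> 0" "poly q r = 0"
      using \<rho>[of k] K x_le[of 0 k] by (auto simp: x_def)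
    \<comment> \<open>The topmost interval is closed at \<open>x 0 = 0\<close>, so 0 is excluded by
      \<open>q(0) = 1\<close>.\<close>
    moreover from this q0 have "r \<noteq> 0"
      by auto
    ultimately show ?thesis
      by simp
  qed
  have "finite (\<rho> ` K)" "poly q 0 > 0"
    using q0 by (simp_all add: K_def)
  then obtain c rs where "\<forall>r\<in>set rs. r < 0" "q = smult c (\<Prod>r\<leftarrow>rs. [:-r, 1:])"
    using splits_over_negative_reals[OF _ roots card lead] by blast
  then show ?thesis
    using that q by blast
qed

theorem theorem3p4:
  fixes d m :: nat
  assumes "d > 0" and "2 \<le> m" and "m \<le> 15"
  shows "n_sequence d (b m d)"
proof -
  have m: "m > 0"
    using assms by simp
  obtain c rs where rs: "\<forall>r\<in>set rs. r < 0"
    and b: "b_poly m (real d) = pcompose (smult c (\<Prod>r\<leftarrow>rs. [:-r, 1:])) [:0, real d, -1:]"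
    using b_poly_splits[of "real d" m] assms(1) m by (metis of_nat_0_less_iff)
  have "b m d = (\<lambda>i. poly (smult c (\<Prod>r\<leftarrow>rs. [:-r, 1:])) (real i * (real d - real i)))"
    by (rule ext) (simp add: b_eq_poly_b_poly[OF m] b poly_pcompose algebra_simps)
  then show ?thesis
    using n_sequence_poly_negative_roots[OF rs, of d c] by simp
qed

end
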